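(* Let $(\Omega,\mathcal{A},\mu)$ be a finite measure space, let $X$ be a Banach space, and let $1\le p<\infty$. If $L^p(\mu,X)$ has $BHP$, then $X$ has $BHP$.
   Context: All Banach spaces are real and nontrivial (this includes $L^p(\mu,X)$, so $\mu(\Omega)>0$). For a Banach space $E$, $B_E$ is the closed unit ball. $E$ has the Ball Huskable Property ($BHP$) if for every $\varepsilon>0$ there is a nonempty relatively weakly open subset of $B_E$ with diameter less than $\varepsilon$. $L^p(\mu,X)$ is the Lebesgue-Bochner space of (equivalence classes of) $p$-integrable (strongly measurable) $X$-valued functions on $\Omega$, with norm $\|f\|_p=\left(\int_\Omega\|f(t)\|^p\,d\mu(t)\right)^{1/p}$. *)

theory Defs
  imports "HOL-Analysis.Analysis"
begin

text \<open>
  Lebesgue--Bochner spaces depend on a measure, which is a term, so they are not types. Real normed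
  spaces are therefore given by explicit carriers, which also allows one definition of the ball
  huskable property to serve both for types of class \<open>banach\<close> and for Lebesgue--Bochner spaces.
\<close>

record 'v nvs =
  pts :: "'v set"
  vadd :: "'v \<Rightarrow> 'v \<Rightarrow> 'v"
  vscale :: "real \<Rightarrow> 'v \<Rightarrow> 'v"
  vnorm :: "'v \<Rightarrow> real"

definition nvs_of_type :: "'a::real_normed_vector itself \<Rightarrow> 'a nvs" where
  "nvs_of_type _ = \<lparr>pts = UNIV, vadd = (+), vscale = scaleR, vnorm = norm\<rparr>"

definition vdist :: "'v nvs \<Rightarrow> 'v \<Rightarrow> 'v \<Rightarrow> real" where
  "vdist E x y = vnorm E (vadd E x (vscale E (-1) y))"

definition unit_ball :: "'v nvs \<Rightarrow> 'v set" where
  "unit_ball E = {x \<in> pts E. vnorm E x \<le> 1}"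

text \<open>Values of a functional outside the carrier are irrelevant and left unconstrained.\<close>

definition dual_space :: "'v nvs \<Rightarrow> ('v \<Rightarrow> real) set" where
  "dual_space E = {\<phi>.
     (\<forall>x\<in>pts E. \<forall>y\<in>pts E. \<phi> (vadd E x y) = \<phi> x + \<phi> y) \<and>
     (\<forall>c. \<forall>x\<in>pts E. \<phi> (vscale E c x) = c * \<phi> x) \<and>
     (\<exists>K. \<forall>x\<in>pts E. \<bar>\<phi> x\<bar> \<le> K * vnorm E x)}"

definition weak_topology :: "'v nvs \<Rightarrow> 'v topology" where
  "weak_topology E =
     topology_generated_by {{x \<in> pts E. \<phi> x \<in> U} | \<phi> U. \<phi> \<in> dual_space E \<and> open U}"

text \<open>Used only for nonempty bounded sets, so that the real-valued supremum is the true one.\<close>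

definition vdiameter :: "'v nvs \<Rightarrow> 'v set \<Rightarrow> real" where
  "vdiameter E S = (SUP (x, y) \<in> S \<times> S. vdist E x y)"

definition BHP :: "'v nvs \<Rightarrow> bool" where
  "BHP E \<longleftrightarrow>
     (\<forall>\<epsilon>>0. \<exists>W. openin (subtopology (weak_topology E) (unit_ball E)) W \<and> W \<noteq> {} \<and>
        vdiameter E W < \<epsilon>)"

text \<open>
  The target need not be separable, so Borel measurability would not do. Limits are
  taken at every point of the space; allowing exceptional null sets would only add further
  representatives to each almost-everywhere class, not new classes.
\<close>

definition strongly_measurable :: "'w measure \<Rightarrow> ('w \<Rightarrow> 'a::real_normed_vector) \<Rightarrow> bool" where
  "strongly_measurable M f \<longleftrightarrow>
     (\<exists>s. (\<forall>n::nat. simple_function M (s n)) \<and> (\<forall>x\<in>space M. (\<lambda>n. s n x) \<longlonglongrightarrow> f x))"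

definition Lp_fun :: "'w measure \<Rightarrow> real \<Rightarrow> ('w \<Rightarrow> 'a::real_normed_vector) set" where
  "Lp_fun M p = {f. strongly_measurable M f \<and> integrable M (\<lambda>x. norm (f x) powr p)}"

definition Lp_seminorm :: "'w measure \<Rightarrow> real \<Rightarrow> ('w \<Rightarrow> 'a::real_normed_vector) \<Rightarrow> real" where
  "Lp_seminorm M p f = (LINT x|M. norm (f x) powr p) powr (1 / p)"

definition Lp_class ::
  "'w measure \<Rightarrow> real \<Rightarrow> ('w \<Rightarrow> 'a::real_normed_vector) \<Rightarrow> ('w \<Rightarrow> 'a) set" where
  "Lp_class M p f = {g \<in> Lp_fun M p. AE x in M. g x = f x}"

text \<open>
  The vectors are the almost-everywhere classes. The operations collect the results for all choices
  of representatives; the lemmas below show that they are the induced ones.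
\<close>

definition Lp_space :: "'w measure \<Rightarrow> real \<Rightarrow> ('w \<Rightarrow> 'a::real_normed_vector) set nvs" where
  "Lp_space M p =
     \<lparr>pts = Lp_class M p ` Lp_fun M p,
      vadd = (\<lambda>F G. \<Union>f\<in>F. \<Union>g\<in>G. Lp_class M p (\<lambda>x. f x + g x)),
      vscale = (\<lambda>c F. \<Union>f\<in>F. Lp_class M p (\<lambda>x. c *\<^sub>R f x)),
      vnorm = (\<lambda>F. the_elem (Lp_seminorm M p ` F))\<rparr>"

lemma strongly_measurable_norm:
  assumes "strongly_measurable M f"
  shows "(\<lambda>x. norm (f x)) \<in> borel_measurable M"
proof -
  obtain s where s: "\<And>n::nat. simple_function M (s n)"
      "\<And>x. x \<in> space M \<Longrightarrow> (\<lambda>n. s n x) \<longlonglongrightarrow> f x"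
    using assms unfolding strongly_measurable_def by blast
  show ?thesis
  proof (rule borel_measurable_LIMSEQ_metric)
    show "(\<lambda>x. norm (s n x)) \<in> borel_measurable M" for n
      using simple_function_compose[OF s(1)[of n], of norm]
      by (simp add: borel_measurable_simple_function comp_def)
    show "(\<lambda>n. norm (s n x)) \<longlonglongrightarrow> norm (f x)" if "x \<in> space M" for x
      using s(2)[OF that] by (rule tendsto_norm)
  qed
qed

lemma strongly_measurable_add:
  assumes "strongly_measurable M f" "strongly_measurable M g"
  shows "strongly_measurable M (\<lambda>x. f x + g x)"
proof -
  obtain s where s: "\<And>n::nat. simple_function M (s n)"
      "\<And>x. x \<in> space M \<Longrightarrow> (\<lambda>n. s n x) \<longlonglongrightarrow> f x"
    using assms(1) unfolding strongly_measurable_def by blast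
  obtain t where t: "\<And>n::nat. simple_function M (t n)"
      "\<And>x. x \<in> space M \<Longrightarrow> (\<lambda>n. t n x) \<longlonglongrightarrow> g x"
    using assms(2) unfolding strongly_measurable_def by blast
  show ?thesis
    unfolding strongly_measurable_def
    using simple_function_compose2[OF s(1) t(1), of "(+)"] tendsto_add[OF s(2) t(2)]
    by (intro exI[of _ "\<lambda>n x. s n x + t n x"]) simp
qed

lemma strongly_measurable_scaleR:
  assumes "strongly_measurable M f"
  shows "strongly_measurable M (\<lambda>x. c *\<^sub>R f x)"
proof -
  obtain s where s: "\<And>n::nat. simple_function M (s n)"
      "\<And>x. x \<in> space M \<Longrightarrow> (\<lambda>n. s n x) \<longlonglongrightarrow> f x"
    using assms unfolding strongly_measurable_def by blast
  show ?thesis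
    unfolding strongly_measurable_def
    using simple_function_compose1[OF s(1), of "scaleR c"] tendsto_scaleR[OF tendsto_const s(2)]
    by (intro exI[of _ "\<lambda>n x. c *\<^sub>R s n x"]) simp
qed

lemma Lp_fun_add:
  assumes "f \<in> Lp_fun M p" "g \<in> Lp_fun M p" "1 \<le> p"
  shows "(\<lambda>x. f x + g x) \<in> Lp_fun M p"
proof -
  have sm: "strongly_measurable M (\<lambda>x. f x + g x)"
    using assms by (auto simp: Lp_fun_def intro: strongly_measurable_add)
  have "integrable M (\<lambda>x. norm (f x + g x) powr p)"
  proof (rule Bochner_Integration.integrable_bound)
    show "integrable M (\<lambda>x. 2 powr p * (norm (f x) powr p + norm (g x) powr p))"
      using assms by (auto simp: Lp_fun_def)
    show "(\<lambda>x. norm (f x + g x) powr p) \<in> borel_measurable M"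
      using strongly_measurable_norm[OF sm] by measurable
    show "AE x in M. norm (norm (f x + g x) powr p)
        \<le> norm (2 powr p * (norm (f x) powr p + norm (g x) powr p))"
    proof (rule AE_I2)
      fix x
      let ?m = "max (norm (f x)) (norm (g x))"
      have "norm (f x + g x) powr p \<le> (2 * ?m) powr p"
        using norm_triangle_ineq[of "f x" "g x"] assms(3) by (intro powr_mono2) auto
      also have "\<dots> = 2 powr p * ?m powr p"
        by (simp add: powr_mult)
      also have "\<dots> \<le> 2 powr p * (norm (f x) powr p + norm (g x) powr p)"
        by (intro mult_left_mono) (auto simp: max_def)
      finally show "norm (norm (f x + g x) powr p)
          \<le> norm (2 powr p * (norm (f x) powr p + norm (g x) powr p))"
        by simp
    qed
  qed
  with sm show ?thesis by (simp add: Lp_fun_def)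
qed

lemma Lp_fun_scaleR:
  assumes "f \<in> Lp_fun M p"
  shows "(\<lambda>x. c *\<^sub>R f x) \<in> Lp_fun M p"
  using assms by (auto simp: Lp_fun_def powr_mult intro: strongly_measurable_scaleR)

lemma Lp_class_self: "f \<in> Lp_fun M p \<Longrightarrow> f \<in> Lp_class M p f"
  by (simp add: Lp_class_def)

lemma Lp_class_cong:
  assumes "AE x in M. f x = g x"
  shows "Lp_class M p f = Lp_class M p g"
  unfolding Lp_class_def
proof (intro Collect_cong conj_cong refl)
  fix h
  show "(AE x in M. h x = f x) \<longleftrightarrow> (AE x in M. h x = g x)"
    by (rule eventually_subst, rule eventually_mono[OF assms]) simp
qed

lemma vnorm_Lp_class:
  assumes "f \<in> Lp_fun M p"
  shows "vnorm (Lp_space M p) (Lp_class M p f) = Lp_seminorm M p f"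
proof -
  have "Lp_seminorm M p g = Lp_seminorm M p f" if "g \<in> Lp_class M p f" for g
  proof -
    have "(\<lambda>x. norm (g x) powr p) \<in> borel_measurable M"
         "(\<lambda>x. norm (f x) powr p) \<in> borel_measurable M"
      using that assms by (simp_all add: Lp_class_def Lp_fun_def borel_measurable_integrable)
    moreover have "AE x in M. norm (g x) powr p = norm (f x) powr p"
      using that by (auto simp: Lp_class_def)
    ultimately have "(LINT x|M. norm (g x) powr p) = (LINT x|M. norm (f x) powr p)"
      by (rule integral_cong_AE)
    then show ?thesis
      by (simp add: Lp_seminorm_def)
  qed
  then have "Lp_seminorm M p ` Lp_class M p f = {Lp_seminorm M p f}"
    using Lp_class_self[OF assms] by blast
  then show ?thesis by (simp add: Lp_space_def)
qed

lemma vadd_Lp_class: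
  assumes "f \<in> Lp_fun M p" "g \<in> Lp_fun M p"
  shows "vadd (Lp_space M p) (Lp_class M p f) (Lp_class M p g) = Lp_class M p (\<lambda>x. f x + g x)"
proof -
  have *: "Lp_class M p (\<lambda>x. f' x + g' x) = Lp_class M p (\<lambda>x. f x + g x)"
    if "f' \<in> Lp_class M p f" "g' \<in> Lp_class M p g" for f' g'
    using that by (intro Lp_class_cong) (auto simp: Lp_class_def)
  have "(\<Union>f'\<in>Lp_class M p f. \<Union>g'\<in>Lp_class M p g. Lp_class M p (\<lambda>x. f' x + g' x))
      = (\<Union>f'\<in>Lp_class M p f. \<Union>g'\<in>Lp_class M p g. Lp_class M p (\<lambda>x. f x + g x))"
    by (intro SUP_cong refl *)
  also have "\<dots> = Lp_class M p (\<lambda>x. f x + g x)"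
    using Lp_class_self[OF assms(1)] Lp_class_self[OF assms(2)] by blast
  finally show ?thesis
    by (simp add: Lp_space_def)
qed

lemma vscale_Lp_class:
  assumes "f \<in> Lp_fun M p"
  shows "vscale (Lp_space M p) c (Lp_class M p f) = Lp_class M p (\<lambda>x. c *\<^sub>R f x)"
proof -
  have *: "Lp_class M p (\<lambda>x. c *\<^sub>R f' x) = Lp_class M p (\<lambda>x. c *\<^sub>R f x)"
    if "f' \<in> Lp_class M p f" for f'
    using that by (intro Lp_class_cong) (auto simp: Lp_class_def)
  have "(\<Union>f'\<in>Lp_class M p f. Lp_class M p (\<lambda>x. c *\<^sub>R f' x))
      = (\<Union>f'\<in>Lp_class M p f. Lp_class M p (\<lambda>x. c *\<^sub>R f x))"
    by (intro SUP_cong refl *)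
  also have "\<dots> = Lp_class M p (\<lambda>x. c *\<^sub>R f x)"
    using Lp_class_self[OF assms] by blast
  finally show ?thesis
    by (simp add: Lp_space_def)
qed

lemma dual_space_of_type:
  "dual_space (nvs_of_type TYPE('a::real_normed_vector)) = {\<phi>. bounded_linear \<phi>}"
  by (auto simp: dual_space_def nvs_of_type_def bounded_linear_def linear_iff
      bounded_linear_axioms_def mult.commute)

lemma unit_ball_of_type:
  "unit_ball (nvs_of_type TYPE('a::real_normed_vector)) = cball 0 1"
  by (auto simp: unit_ball_def nvs_of_type_def)

lemma vdiameter_of_type:
  "S \<noteq> {} \<Longrightarrow> vdiameter (nvs_of_type TYPE('a::real_normed_vector)) S = diameter S"
  by (simp add: vdiameter_def vdist_def nvs_of_type_def diameter_def dist_norm case_prod_unfold)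

end

theory Submission
  imports Defs
begin

text \<open>
  Suppose every nonempty relatively weakly open subset of \<open>B\<^sub>X\<close> has diameter at least \<open>\<epsilon>\<close>, and let \<open>W\<close>
  be such a subset of the unit ball of \<open>L\<^sup>p\<close>. Simple functions are norm dense in the ball, so \<open>W\<close>
  contains a simple \<open>s\<close>. Enlarge the norms \<open>\<parallel>v\<parallel>\<close> of its values to radii \<open>r v\<close> such that \<open>r \<circ> s\<close> has
  \<open>L\<^sup>p\<close> norm exactly \<open>1\<close>. A functional on \<open>L\<^sup>p\<close> restricts, on each level set of \<open>s\<close>, to a functional
  on \<open>X\<close>; hence every value \<open>v\<close> may be moved within a relatively weakly open subset of the ball of
  radius \<open>r v\<close> without leaving \<open>W\<close>. That subset contains two points at distance at least
  \<open>r v * \<epsilon> / 2\<close>, and doing this for all values at once yields two functions in \<open>W\<close> at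
  distance at least \<open>\<epsilon> / 2\<close>.
\<close>

section \<open>Weak neighbourhoods, and distant points in them when \<open>BHP\<close> fails\<close>

text \<open>Induction on how the open set is generated: a subbasic set needs one functional, unions
  inherit the neighbourhood of a member, and an intersection joins the two finite sets and takes the
  smaller radius.\<close>

lemma weak_topology_basic_nbhd:
  assumes "openin (weak_topology E) T" "x \<in> T"
  obtains F \<eta> where "finite F" "F \<subseteq> dual_space E" "0 < \<eta>"
    "\<And>y. y \<in> pts E \<Longrightarrow> (\<And>\<phi>. \<phi> \<in> F \<Longrightarrow> \<bar>\<phi> y - \<phi> x\<bar> < \<eta>) \<Longrightarrow> y \<in> T"
proof -
  let ?S = "{{x \<in> pts E. \<phi> x \<in> U} | \<phi> U. \<phi> \<in> dual_space E \<and> open U}"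
  let ?P = "\<lambda>T x. \<exists>F \<eta>. finite F \<and> F \<subseteq> dual_space E \<and> 0 < \<eta> \<and>
    (\<forall>y\<in>pts E. (\<forall>\<phi>\<in>F. \<bar>\<phi> y - \<phi> x\<bar> < \<eta>) \<longrightarrow> y \<in> T)"
  have "generate_topology_on ?S T"
    using assms(1) by (simp add: weak_topology_def openin_topology_generated_by_iff)
  then have "\<forall>x\<in>T. ?P T x"
  proof (induction rule: generate_topology_on.induct)
    case Empty
    then show ?case by simp
  next
    case (Int A B)
    show ?case
    proof
      fix x assume "x \<in> A \<inter> B"
      then have x: "x \<in> A" "x \<in> B" by auto
      obtain F \<eta> where F: "finite F" "F \<subseteq> dual_space E" "0 < \<eta>"
          "\<forall>y\<in>pts E. (\<forall>\<phi>\<in>F. \<bar>\<phi> y - \<phi> x\<bar> < \<eta>) \<longrightarrow> y \<in> A"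
        using bspec[OF Int.IH(1) x(1)] by (elim exE conjE)
      obtain G \<theta> where G: "finite G" "G \<subseteq> dual_space E" "0 < \<theta>"
          "\<forall>y\<in>pts E. (\<forall>\<phi>\<in>G. \<bar>\<phi> y - \<phi> x\<bar> < \<theta>) \<longrightarrow> y \<in> B"
        using bspec[OF Int.IH(2) x(2)] by (elim exE conjE)
      show "?P (A \<inter> B) x"
        by (rule exI[of _ "F \<union> G"], rule exI[of _ "min \<eta> \<theta>"]) (use F G in auto)
    qed
  next
    case (UN K)
    show ?case
    proof
      fix x assume "x \<in> \<Union>K"
      then obtain A where A: "A \<in> K" "x \<in> A" by blast
      obtain F \<eta> where F: "finite F" "F \<subseteq> dual_space E" "0 < \<eta>"
          "\<forall>y\<in>pts E. (\<forall>\<phi>\<in>F. \<bar>\<phi> y - \<phi> x\<bar> < \<eta>) \<longrightarrow> y \<in> A"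
        using bspec[OF UN.IH[OF A(1)] A(2)] by (elim exE conjE)
      then show "?P (\<Union>K) x"
        using A(1) by (intro exI[of _ F] exI[of _ \<eta>]) blast
    qed
  next
    case (Basis A)
    then obtain \<phi> U where A: "A = {x \<in> pts E. \<phi> x \<in> U}" "\<phi> \<in> dual_space E" "open U"
      by blast
    show ?case
    proof
      fix x assume "x \<in> A"
      then have "\<phi> x \<in> U" using A by simp
      then obtain \<eta> where "0 < \<eta>" "\<forall>t. dist t (\<phi> x) < \<eta> \<longrightarrow> t \<in> U"
        using A(3) by (auto simp: open_dist)
      then show "?P A x"
        using A by (intro exI[of _ "{\<phi>}"] exI[of _ \<eta>]) (auto simp: dist_real_def)
    qed
  qed
  from bspec[OF this assms(2)] show ?thesis
    by (elim exE conjE, intro that) blast+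
qed

text \<open>Dividing by \<open>r\<close> reduces to the unit ball: the constraints become a
  relatively weakly open set containing \<open>(1/r) *\<^sub>R x\<close>, whose diameter is at least
  \<open>\<epsilon>\<close>. For \<open>r = 0\<close> the ball is a single point and the claimed
  distance is \<open>0\<close>.\<close>

lemma not_BHP_far_points:
  fixes x :: "'a::real_normed_vector" and F :: "('a \<Rightarrow> real) set"
  assumes diam: "\<And>W. openin (subtopology (weak_topology (nvs_of_type TYPE('a)))
        (unit_ball (nvs_of_type TYPE('a)))) W \<Longrightarrow> W \<noteq> {} \<Longrightarrow>
      \<epsilon> \<le> vdiameter (nvs_of_type TYPE('a)) W"
    and "0 < \<epsilon>" "finite F" "\<And>\<psi>. \<psi> \<in> F \<Longrightarrow> bounded_linear \<psi>" "0 < \<eta>" "norm x \<le> r"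
  obtains y z where "norm y \<le> r" "norm z \<le> r" "r * (\<epsilon> / 2) \<le> norm (y - z)"
    "\<And>\<psi>. \<psi> \<in> F \<Longrightarrow> \<bar>\<psi> y - \<psi> x\<bar> < \<eta>" "\<And>\<psi>. \<psi> \<in> F \<Longrightarrow> \<bar>\<psi> z - \<psi> x\<bar> < \<eta>"
proof (cases "r = 0")
  case True
  with assms(6) have "x = 0" by simp
  show ?thesis by (rule that[of x x]) (use True assms \<open>x = 0\<close> in auto)
next
  case False
  then have r: "0 < r" using assms(6) norm_ge_zero[of x] by linarith
  let ?E = "nvs_of_type TYPE('a)"
  \<comment> \<open>The condition on \<open>r *\<^sub>R u\<close>, pulled back to \<open>u\<close>
    through \<open>\<psi> (r *\<^sub>R u) = r * \<psi> u\<close>.\<close>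
  define S where "S \<psi> = {u \<in> pts ?E. \<psi> u \<in> {t. \<bar>r * t - \<psi> x\<bar> < \<eta>}}" for \<psi> :: "'a \<Rightarrow> real"
  have pts: "pts ?E = UNIV" by (simp add: nvs_of_type_def)
  have opS: "openin (weak_topology ?E) (S \<psi>)" if "bounded_linear \<psi>" for \<psi>
  proof -
    have "open {t::real. \<bar>r * t - \<psi> x\<bar> < \<eta>}"
      by (intro open_Collect_less continuous_intros)
    then show ?thesis
      unfolding weak_topology_def S_def
      using that by (intro topology_generated_by_Basis CollectI exI[of _ \<psi>]
          exI[of _ "{t. \<bar>r * t - \<psi> x\<bar> < \<eta>}"] conjI refl) (auto simp: dual_space_of_type)
  qed
  \<comment> \<open>The zero functional shows that the whole space is open; this settles an empty
    \<open>F\<close>.\<close>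
  have "(\<lambda>_. 0) \<in> dual_space ?E"
    by (simp add: dual_space_of_type)
  then have opU: "openin (weak_topology ?E) UNIV"
    unfolding weak_topology_def
    by (intro topology_generated_by_Basis)
       (auto simp: pts intro!: exI[of _ "\<lambda>_. 0"] exI[of _ UNIV])
  define T where "T = UNIV \<inter> \<Inter>(S ` F)"
  have "openin (weak_topology ?E) T"
    unfolding T_def using opU opS assms(3,4)
    by (cases "F = {}") auto
  then have "openin (subtopology (weak_topology ?E) (unit_ball ?E)) (unit_ball ?E \<inter> T)"
    by (simp add: openin_subtopology_Int2)
  moreover have "(1/r) *\<^sub>R x \<in> unit_ball ?E \<inter> T"
    using r assms by (auto simp: T_def S_def pts unit_ball_of_type linear_simps)
  ultimately have ge: "\<epsilon> \<le> vdiameter ?E (unit_ball ?E \<inter> T)" and ne: "unit_ball ?E \<inter> T \<noteq> {}"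
    using diam by auto
  \<comment> \<open>The supremum need not be attained, so only half of \<open>\<epsilon>\<close> is
    claimed.\<close>
  have "\<exists>u\<in>unit_ball ?E \<inter> T. \<exists>v\<in>unit_ball ?E \<inter> T. \<epsilon> / 2 < norm (u - v)"
  proof (rule ccontr)
    assume "\<not> ?thesis"
    then have "vdiameter ?E (unit_ball ?E \<inter> T) \<le> \<epsilon> / 2"
      unfolding vdiameter_def using ne
      by (intro cSUP_least) (auto simp: vdist_def nvs_of_type_def not_less)
    with ge \<open>0 < \<epsilon>\<close> show False by simp
  qed
  then obtain u v where uv: "u \<in> unit_ball ?E \<inter> T" "v \<in> unit_ball ?E \<inter> T" "\<epsilon> / 2 < norm (u - v)"
    by blast
  show ?thesis
  proof (rule that[of "r *\<^sub>R u" "r *\<^sub>R v"])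
    show "r * (\<epsilon> / 2) \<le> norm (r *\<^sub>R u - r *\<^sub>R v)"
      using uv(3) r by (simp flip: scaleR_diff_right)
  qed (use uv r assms(4) in \<open>auto simp: unit_ball_of_type T_def S_def linear_simps\<close>)
qed

section \<open>Simple functions and approximation by them\<close>

lemma strongly_measurable_simple_function:
  "simple_function M s \<Longrightarrow> strongly_measurable M s"
  unfolding strongly_measurable_def by (intro exI[of _ "\<lambda>_. s"]) simp

lemma (in finite_measure) Lp_fun_simple_function:
  assumes "simple_function M s"
  shows "s \<in> Lp_fun M p"
proof -
  have "simple_function M (\<lambda>x. norm (s x) powr p)"
    using simple_function_compose1[OF assms, of "\<lambda>v. norm v powr p"] .
  then have "integrable M (\<lambda>x. norm (s x) powr p)"
    by (intro integrable_simple_function) (auto simp: emeasure_eq_measure)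
  then show ?thesis
    using assms by (simp add: Lp_fun_def strongly_measurable_simple_function)
qed

text \<open>
  The approximants are products of simple lower approximations of \<open>\<parallel>f\<parallel>\<close> and the directions of
  simple approximations of \<open>f\<close>, so their norms do not exceed that of \<open>f\<close>.
\<close>

lemma strongly_measurable_dominated_approx:
  fixes f :: "'w \<Rightarrow> 'a::real_normed_vector"
  assumes "strongly_measurable M f"
  obtains s where "\<And>n::nat. simple_function M (s n)"
    "\<And>n x. x \<in> space M \<Longrightarrow> norm (s n x) \<le> norm (f x)"
    "\<And>x. x \<in> space M \<Longrightarrow> (\<lambda>n. s n x) \<longlonglongrightarrow> f x"
proof -
  obtain t where t: "\<And>n::nat. simple_function M (t n)"
      "\<And>x. x \<in> space M \<Longrightarrow> (\<lambda>n. t n x) \<longlonglongrightarrow> f x"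
    using assms unfolding strongly_measurable_def by blast
  have "(\<lambda>x. norm (f x)) \<in> borel_measurable M"
    using assms by (rule strongly_measurable_norm)
  then obtain r where r: "incseq r" "\<And>n::nat. simple_function M (r n)"
      "\<And>x. bdd_above (range (\<lambda>n. r n x))" "\<And>n x. 0 \<le> r n x"
      "(\<lambda>x. norm (f x)) = (SUP n. r n)"
    using borel_measurable_implies_simple_function_sequence_real[of "\<lambda>x. norm (f x)" M] by auto
  have r_lim: "(\<lambda>n. r n x) \<longlonglongrightarrow> norm (f x)" for x
    using LIMSEQ_incseq_SUP[OF r(3), of x] r(1) fun_cong[OF r(5), of x]
    by (simp add: mono_def le_fun_def image_image)
  have r_le: "r n x \<le> norm (f x)" for n x
    using incseq_le[OF _ r_lim, of x n] r(1) by (simp add: mono_def le_fun_def)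
  show ?thesis
  proof (rule that[of "\<lambda>n x. r n x *\<^sub>R sgn (t n x)"])
    show "simple_function M (\<lambda>x. r n x *\<^sub>R sgn (t n x))" for n
      using simple_function_compose2[OF r(2) t(1), of "\<lambda>a b. a *\<^sub>R sgn b"] .
    show "norm (r n x *\<^sub>R sgn (t n x)) \<le> norm (f x)" for n x
      using r_le[of n x] r(4)[of n x] by (simp add: norm_sgn)
    \<comment> \<open>\<open>sgn\<close> is discontinuous at \<open>0\<close>, so zeros of
      \<open>f\<close> are treated apart; there every \<open>r n x\<close> vanishes.\<close>
    show "(\<lambda>n. r n x *\<^sub>R sgn (t n x)) \<longlonglongrightarrow> f x" if x: "x \<in> space M" for x
    proof (cases "f x = 0")
      case True
      then have "r n x = 0" for n using r_le[of n x] r(4)[of n x] by simp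
      then show ?thesis using True by simp
    next
      case False
      have "(\<lambda>n. r n x *\<^sub>R sgn (t n x)) \<longlonglongrightarrow> norm (f x) *\<^sub>R sgn (f x)"
        using r_lim t(2)[OF x] False by (intro tendsto_intros)
      then show ?thesis using False by (simp add: sgn_div_norm)
    qed
  qed
qed

text \<open>Dominated convergence: \<open>norm (s n x) \<le> norm (f x)\<close> makes
  \<open>2 powr p * norm (f x) powr p\<close> an integrable majorant.\<close>

lemma integral_powr_norm_diff_tendsto_zero:
  fixes f :: "'w \<Rightarrow> 'a::real_normed_vector"
  assumes "f \<in> Lp_fun M p" "1 \<le> p" "\<And>n::nat. strongly_measurable M (s n)"
    "\<And>n x. x \<in> space M \<Longrightarrow> norm (s n x) \<le> norm (f x)"
    "\<And>x. x \<in> space M \<Longrightarrow> (\<lambda>n. s n x) \<longlonglongrightarrow> f x"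
  shows "(\<lambda>n. LINT x|M. norm (s n x - f x) powr p) \<longlonglongrightarrow> 0"
proof -
  have "(\<lambda>n. LINT x|M. norm (s n x - f x) powr p) \<longlonglongrightarrow> (LINT x|M. 0)"
  proof (rule integral_dominated_convergence)
    show "integrable M (\<lambda>x. 2 powr p * norm (f x) powr p)"
      using assms(1) by (auto simp: Lp_fun_def)
    show "(\<lambda>x. norm (s n x - f x) powr p) \<in> borel_measurable M" for n
    proof -
      have "strongly_measurable M f" using assms(1) by (simp add: Lp_fun_def)
      from strongly_measurable_norm[OF strongly_measurable_add[OF assms(3)
            strongly_measurable_scaleR[OF this, of "-1"]]]
      have "(\<lambda>x. norm (s n x - f x)) \<in> borel_measurable M" by simp
      then show ?thesis by measurable
    qed
    show "AE x in M. (\<lambda>n. norm (s n x - f x) powr p) \<longlonglongrightarrow> 0"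
    proof (rule AE_I2)
      fix x assume "x \<in> space M"
      then have "(\<lambda>n. norm (s n x - f x)) \<longlonglongrightarrow> 0"
        using assms(5) by (intro tendsto_norm_zero) (simp add: LIM_zero)
      then show "(\<lambda>n. norm (s n x - f x) powr p) \<longlonglongrightarrow> 0"
        using assms(2) by (intro tendsto_zero_powrI[OF _ tendsto_const]) auto
    qed
    show "AE x in M. norm (norm (s n x - f x) powr p) \<le> 2 powr p * norm (f x) powr p" for n
    proof (rule AE_I2)
      fix x assume "x \<in> space M"
      then have "norm (s n x - f x) \<le> 2 * norm (f x)"
        using assms(4)[of x n] norm_triangle_ineq4[of "s n x" "f x"] by linarith
      then have "norm (s n x - f x) powr p \<le> (2 * norm (f x)) powr p"
        using assms(2) by (intro powr_mono2) auto
      then show "norm (norm (s n x - f x) powr p) \<le> 2 powr p * norm (f x) powr p"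
        by (simp add: powr_mult)
    qed
  qed simp_all
  then show ?thesis by simp
qed

section \<open>Distances and the unit ball in \<open>Lp_space\<close>\<close>

lemma pts_Lp_space: "pts (Lp_space M p) = Lp_class M p ` Lp_fun M p"
  by (simp add: Lp_space_def)

lemma Lp_fun_diff:
  assumes "f \<in> Lp_fun M p" "g \<in> Lp_fun M p" "1 \<le> p"
  shows "(\<lambda>x. f x - g x) \<in> Lp_fun M p"
  using Lp_fun_add[OF assms(1) Lp_fun_scaleR[OF assms(2), of "-1"] assms(3)] by simp

lemma vdist_Lp_class:
  assumes "f \<in> Lp_fun M p" "g \<in> Lp_fun M p" "1 \<le> p"
  shows "vdist (Lp_space M p) (Lp_class M p f) (Lp_class M p g) = Lp_seminorm M p (\<lambda>x. f x - g x)"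
  using vnorm_Lp_class[OF Lp_fun_diff[OF assms]]
    vadd_Lp_class[OF assms(1) Lp_fun_scaleR[OF assms(2), of "-1"]]
  by (simp add: vdist_def vscale_Lp_class assms)

lemma Lp_class_in_unit_ball_iff:
  assumes "f \<in> Lp_fun M p" "1 \<le> p"
  shows "Lp_class M p f \<in> unit_ball (Lp_space M p) \<longleftrightarrow> (LINT x|M. norm (f x) powr p) \<le> 1"
proof -
  have "t powr (1 / p) \<le> 1 \<longleftrightarrow> t \<le> 1" if "0 \<le> t" for t
  proof
    assume "t powr (1 / p) \<le> 1"
    then have "(t powr (1 / p)) powr p \<le> 1 powr p"
      using assms(2) by (intro powr_mono2) auto
    then show "t \<le> 1" using that assms(2) by (simp add: powr_powr)
  next
    assume "t \<le> 1"
    then show "t powr (1 / p) \<le> 1" using that assms(2) by (intro powr_le1) auto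
  qed
  then show ?thesis
    using assms by (simp add: unit_ball_def pts_Lp_space vnorm_Lp_class Lp_seminorm_def)
qed

text \<open>Boundedness lets the real supremum in \<open>vdiameter\<close> dominate each single
  distance. Any bound will do, so a pointwise estimate with factor \<open>2 powr p\<close> replaces
  the Minkowski inequality; the further factor \<open>2\<close> comes from two integrals of at most
  \<open>1\<close>.\<close>

lemma bdd_above_vdist_Lp_unit_ball:
  assumes "1 \<le> p"
  shows "bdd_above ((\<lambda>(F, G). vdist (Lp_space M p :: ('w \<Rightarrow> 'a::real_normed_vector) set nvs) F G) `
    (unit_ball (Lp_space M p) \<times> unit_ball (Lp_space M p)))"
proof (rule bdd_aboveI2, clarify)
  fix F G :: "('w \<Rightarrow> 'a) set"
  assume FG: "F \<in> unit_ball (Lp_space M p)" "G \<in> unit_ball (Lp_space M p)"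
  then obtain f g where f: "f \<in> Lp_fun M p" "F = Lp_class M p f"
    and g: "g \<in> Lp_fun M p" "G = Lp_class M p g"
    by (auto simp: unit_ball_def pts_Lp_space)
  have "(LINT x|M. norm (f x - g x) powr p)
      \<le> (LINT x|M. 2 powr p * (norm (f x) powr p + norm (g x) powr p))"
  proof (rule integral_mono)
    show "integrable M (\<lambda>x. norm (f x - g x) powr p)"
      using Lp_fun_diff[OF f(1) g(1) assms] by (simp add: Lp_fun_def)
    show "integrable M (\<lambda>x. 2 powr p * (norm (f x) powr p + norm (g x) powr p))"
      using f(1) g(1) by (simp add: Lp_fun_def)
    fix x
    let ?m = "max (norm (f x)) (norm (g x))"
    have "norm (f x - g x) powr p \<le> (2 * ?m) powr p"
      using norm_triangle_ineq4[of "f x" "g x"] assms by (intro powr_mono2) auto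
    also have "\<dots> = 2 powr p * ?m powr p"
      by (simp add: powr_mult)
    also have "\<dots> \<le> 2 powr p * (norm (f x) powr p + norm (g x) powr p)"
      by (intro mult_left_mono) (auto simp: max_def)
    finally show "norm (f x - g x) powr p \<le> 2 powr p * (norm (f x) powr p + norm (g x) powr p)" .
  qed
  also have "\<dots> = 2 powr p * ((LINT x|M. norm (f x) powr p) + (LINT x|M. norm (g x) powr p))"
    using f(1) g(1) by (simp add: Lp_fun_def)
  also have "\<dots> \<le> 2 powr p * 2"
    using FG f g assms Lp_class_in_unit_ball_iff[OF f(1)] Lp_class_in_unit_ball_iff[OF g(1)]
    by (intro mult_left_mono) auto
  finally have "Lp_seminorm M p (\<lambda>x. f x - g x) \<le> (2 powr p * 2) powr (1 / p)"
    unfolding Lp_seminorm_def using assms by (intro powr_mono2) auto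
  then show "vdist (Lp_space M p) F G \<le> (2 powr p * 2) powr (1 / p)"
    using f g assms by (simp add: vdist_Lp_class)
qed

section \<open>Functionals on \<open>Lp_space\<close> and their action on simple functions\<close>

context
  fixes M :: "'w measure" and p :: real and \<phi> :: "('w \<Rightarrow> 'a::real_normed_vector) set \<Rightarrow> real"
  assumes p: "1 \<le> p" and \<phi>: "\<phi> \<in> dual_space (Lp_space M p)"
begin

lemma dual_Lp_add:
  assumes "f \<in> Lp_fun M p" "g \<in> Lp_fun M p"
  shows "\<phi> (Lp_class M p (\<lambda>x. f x + g x)) = \<phi> (Lp_class M p f) + \<phi> (Lp_class M p g)"
  using \<phi> assms by (auto simp: dual_space_def pts_Lp_space simp flip: vadd_Lp_class)

lemma dual_Lp_scaleR:
  assumes "f \<in> Lp_fun M p"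
  shows "\<phi> (Lp_class M p (\<lambda>x. c *\<^sub>R f x)) = c * \<phi> (Lp_class M p f)"
  using \<phi> assms by (auto simp: dual_space_def pts_Lp_space simp flip: vscale_Lp_class)

lemma dual_Lp_diff:
  assumes "f \<in> Lp_fun M p" "g \<in> Lp_fun M p"
  shows "\<phi> (Lp_class M p (\<lambda>x. f x - g x)) = \<phi> (Lp_class M p f) - \<phi> (Lp_class M p g)"
  using dual_Lp_add[OF assms(1) Lp_fun_scaleR[OF assms(2), of "-1"]]
    dual_Lp_scaleR[OF assms(2), of "-1"] by simp

lemma dual_Lp_bound:
  obtains K where "\<And>f. f \<in> Lp_fun M p \<Longrightarrow> \<bar>\<phi> (Lp_class M p f)\<bar> \<le> K * Lp_seminorm M p f"
proof -
  obtain K where "\<forall>F\<in>pts (Lp_space M p). \<bar>\<phi> F\<bar> \<le> K * vnorm (Lp_space M p) F"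
    using \<phi> by (auto simp: dual_space_def)
  then have "\<bar>\<phi> (Lp_class M p f)\<bar> \<le> K * Lp_seminorm M p f" if "f \<in> Lp_fun M p" for f
    using that by (auto simp: pts_Lp_space simp flip: vnorm_Lp_class)
  then show ?thesis by (rule that)
qed

text \<open>Boundedness of \<open>\<phi>\<close> turns norm convergence into convergence of values:
  the difference is at most \<open>K\<close> times the seminorm of \<open>s n - f\<close>.\<close>

lemma dual_Lp_tendsto:
  assumes "f \<in> Lp_fun M p" "\<And>n::nat. s n \<in> Lp_fun M p"
    "(\<lambda>n. LINT x|M. norm (s n x - f x) powr p) \<longlonglongrightarrow> 0"
  shows "(\<lambda>n. \<phi> (Lp_class M p (s n))) \<longlonglongrightarrow> \<phi> (Lp_class M p f)"
proof -
  obtain K where K: "\<And>f. f \<in> Lp_fun M p \<Longrightarrow> \<bar>\<phi> (Lp_class M p f)\<bar> \<le> K * Lp_seminorm M p f"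
    using dual_Lp_bound by blast
  have lim: "(\<lambda>n. K * Lp_seminorm M p (\<lambda>x. s n x - f x)) \<longlonglongrightarrow> 0"
    unfolding Lp_seminorm_def using p
    by (intro tendsto_mult_right_zero tendsto_zero_powrI[OF assms(3) tendsto_const]) auto
  have "(\<lambda>n. \<phi> (Lp_class M p (s n)) - \<phi> (Lp_class M p f)) \<longlonglongrightarrow> 0"
  proof (rule Lim_null_comparison[OF _ lim], rule eventuallyI)
    show "norm (\<phi> (Lp_class M p (s n)) - \<phi> (Lp_class M p f))
        \<le> K * Lp_seminorm M p (\<lambda>x. s n x - f x)" for n
      using K[OF Lp_fun_diff[OF assms(2,1) p]] dual_Lp_diff[OF assms(2,1)] by simp
  qed
  then show ?thesis by (simp add: LIM_zero_iff)
qed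

text \<open>Membership is carried along in the induction because additivity of \<open>\<phi>\<close>
  applies to a partial sum only once that sum is known to lie in \<open>Lp_fun M p\<close>.\<close>

lemma dual_Lp_sum:
  assumes "finite I" "\<And>i. i \<in> I \<Longrightarrow> f i \<in> Lp_fun M p"
  shows "(\<lambda>x. \<Sum>i\<in>I. f i x) \<in> Lp_fun M p \<and>
    \<phi> (Lp_class M p (\<lambda>x. \<Sum>i\<in>I. f i x)) = (\<Sum>i\<in>I. \<phi> (Lp_class M p (f i)))"
  using assms
proof (induction I rule: finite_induct)
  case empty
  \<comment> \<open>\<open>\<phi>\<close> vanishes on the zero class because the zero function is
    \<open>0\<close> times itself.\<close>
  have z: "(\<lambda>_. 0) \<in> Lp_fun M p"
    by (simp add: Lp_fun_def strongly_measurable_simple_function)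
  show ?case using z dual_Lp_scaleR[OF z, of 0] by simp
next
  case (insert i I)
  then show ?case
    using Lp_fun_add[OF _ _ p, of "f i" M "\<lambda>x. \<Sum>i\<in>I. f i x"] dual_Lp_add by simp
qed

text \<open>Sending \<open>v\<close> to the function equal to \<open>v\<close> on \<open>A\<close>
  and \<open>0\<close> elsewhere is linear and multiplies norms by
  \<open>measure M A powr (1 / p)\<close>; the functional here is \<open>\<phi>\<close> composed
  with this map.\<close>

lemma dual_Lp_indicator_bounded_linear:
  assumes "finite_measure M" "A \<in> sets M"
  shows "bounded_linear (\<lambda>v. \<phi> (Lp_class M p (\<lambda>x. indicator A x *\<^sub>R v)))"
proof -
  interpret finite_measure M by fact
  have sf: "simple_function M (\<lambda>x. indicator A x *\<^sub>R v)" for v :: 'a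
    using simple_function_compose1[OF simple_function_indicator[OF assms(2)], of "\<lambda>c::real. c *\<^sub>R v"] .
  note Lp = Lp_fun_simple_function[OF sf]
  obtain K where K: "\<And>f. f \<in> Lp_fun M p \<Longrightarrow> \<bar>\<phi> (Lp_class M p f)\<bar> \<le> K * Lp_seminorm M p f"
    using dual_Lp_bound by blast
  have sn: "Lp_seminorm M p (\<lambda>x. indicator A x *\<^sub>R v) = norm v * measure M A powr (1 / p)" for v :: 'a
  proof -
    have "(LINT x|M. norm (indicator A x *\<^sub>R v) powr p) = (LINT x|M. indicator A x * norm v powr p)"
      by (intro Bochner_Integration.integral_cong) (auto simp: indicator_def)
    also have "\<dots> = measure M A * norm v powr p"
      using assms(2) by (simp add: emeasure_eq_measure)
    finally have *: "(LINT x|M. norm (indicator A x *\<^sub>R v) powr p) = measure M A * norm v powr p" .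
    show ?thesis
      unfolding Lp_seminorm_def * using p by (simp add: powr_mult powr_powr)
  qed
  show ?thesis
  proof (rule bounded_linear_intro)
    show "\<phi> (Lp_class M p (\<lambda>x. indicator A x *\<^sub>R (u + v)))
        = \<phi> (Lp_class M p (\<lambda>x. indicator A x *\<^sub>R u)) + \<phi> (Lp_class M p (\<lambda>x. indicator A x *\<^sub>R v))" for u v
      using dual_Lp_add[OF Lp Lp] by (simp add: scaleR_add_right)
    show "\<phi> (Lp_class M p (\<lambda>x. indicator A x *\<^sub>R (c *\<^sub>R v)))
        = c *\<^sub>R \<phi> (Lp_class M p (\<lambda>x. indicator A x *\<^sub>R v))" for c v
      using dual_Lp_scaleR[OF Lp, of c v] by (simp add: mult.commute)
    show "norm (\<phi> (Lp_class M p (\<lambda>x. indicator A x *\<^sub>R v)))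
        \<le> norm v * (K * measure M A powr (1 / p))" for v
      using K[OF Lp, of v] by (simp add: sn mult_ac)
  qed
qed

text \<open>The map \<open>y\<close> relabels the values of \<open>s\<close> while the level sets
  stay fixed, so one finite family of functionals on the value space describes \<open>\<phi>\<close>
  for all relabellings at once.\<close>

lemma dual_Lp_simple_function:
  assumes "finite_measure M" "simple_function M s"
  shows "\<phi> (Lp_class M p (\<lambda>x. y (s x)))
    = (\<Sum>v\<in>s ` space M. \<phi> (Lp_class M p (\<lambda>x. indicator (s -` {v} \<inter> space M) x *\<^sub>R y v)))"
proof -
  interpret finite_measure M by fact
  have A: "s -` {v} \<inter> space M \<in> sets M" for v
    using assms(2) by (rule simple_functionD)
  have fin: "finite (s ` space M)"
    using assms(2) by (rule simple_functionD)
  have "(\<Sum>v\<in>s ` space M. indicator (s -` {v} \<inter> space M) x *\<^sub>R y v) = y (s x)"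
    if "x \<in> space M" for x
  proof -
    have "(\<Sum>v\<in>s ` space M. indicator (s -` {v} \<inter> space M) x *\<^sub>R y v)
        = (\<Sum>v\<in>s ` space M. if v = s x then y v else 0)"
      using that by (intro sum.cong) (auto simp: indicator_def)
    also have "\<dots> = y (s x)"
      using that fin by simp
    finally show ?thesis .
  qed
  \<comment> \<open>The pointwise identity holds on \<open>space M\<close> only, which is enough for
    equality of classes.\<close>
  then have "Lp_class M p (\<lambda>x. y (s x))
      = Lp_class M p (\<lambda>x. \<Sum>v\<in>s ` space M. indicator (s -` {v} \<inter> space M) x *\<^sub>R y v)"
    by (intro Lp_class_cong AE_I2) simp
  moreover have "(\<lambda>x. indicator (s -` {v} \<inter> space M) x *\<^sub>R y v) \<in> Lp_fun M p" for v
    using simple_function_compose1[OF simple_function_indicator[OF A], of "\<lambda>c::real. c *\<^sub>R y v"]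
    by (rule Lp_fun_simple_function)
  ultimately show ?thesis
    using dual_Lp_sum[OF fin] by simp
qed

end

text \<open>Approximants dominated by a representative of \<open>F\<close> stay in the ball and
  converge to it in norm. A weak neighbourhood tests finitely many functionals, so a single late
  index passes all tests.\<close>

lemma weakly_open_contains_simple_function:
  assumes "finite_measure M" "1 \<le> p"
    and T: "openin (weak_topology (Lp_space M p)) T"
    and F: "F \<in> T" "F \<in> unit_ball (Lp_space M p)"
  obtains s where "simple_function M s" "Lp_class M p s \<in> T"
    "(LINT x|M. norm (s x) powr p) \<le> 1"
proof -
  interpret finite_measure M by fact
  obtain f where f: "f \<in> Lp_fun M p" "F = Lp_class M p f"
    using F(2) by (auto simp: unit_ball_def pts_Lp_space)
  obtain s where s: "\<And>n::nat. simple_function M (s n)"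
    "\<And>n x. x \<in> space M \<Longrightarrow> norm (s n x) \<le> norm (f x)"
    "\<And>x. x \<in> space M \<Longrightarrow> (\<lambda>n. s n x) \<longlonglongrightarrow> f x"
    using strongly_measurable_dominated_approx[of M f] f(1) by (auto simp: Lp_fun_def)
  have sLp: "s n \<in> Lp_fun M p" for n
    using s(1) by (rule Lp_fun_simple_function)
  obtain D \<eta> where D: "finite D" "D \<subseteq> dual_space (Lp_space M p)" "0 < \<eta>"
    "\<And>y. y \<in> pts (Lp_space M p) \<Longrightarrow> (\<And>\<phi>. \<phi> \<in> D \<Longrightarrow> \<bar>\<phi> y - \<phi> F\<bar> < \<eta>) \<Longrightarrow> y \<in> T"
    using weak_topology_basic_nbhd[OF T F(1)] by metis
  have "\<forall>\<^sub>F n in sequentially. \<forall>\<phi>\<in>D. dist (\<phi> (Lp_class M p (s n))) (\<phi> F) < \<eta>"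
  proof (rule eventually_ball_finite[OF D(1)], rule ballI)
    fix \<phi> assume "\<phi> \<in> D"
    then have "(\<lambda>n. \<phi> (Lp_class M p (s n))) \<longlonglongrightarrow> \<phi> F"
      unfolding f(2) using D(2) s
      by (intro dual_Lp_tendsto[OF assms(2) _ f(1) sLp]
          integral_powr_norm_diff_tendsto_zero[OF f(1) assms(2)]
          strongly_measurable_simple_function) auto
    then show "\<forall>\<^sub>F n in sequentially. dist (\<phi> (Lp_class M p (s n))) (\<phi> F) < \<eta>"
      using D(3) by (rule tendstoD)
  qed
  then obtain n where "\<forall>\<phi>\<in>D. dist (\<phi> (Lp_class M p (s n))) (\<phi> F) < \<eta>"
    by (auto simp: eventually_sequentially)
  then have "Lp_class M p (s n) \<in> T"
    using sLp by (intro D(4)) (auto simp: pts_Lp_space dist_real_def)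
  moreover have "(LINT x|M. norm (s n x) powr p) \<le> (LINT x|M. norm (f x) powr p)"
    using f(1) sLp[of n] s(2) assms(2)
    by (intro integral_mono powr_mono2) (auto simp: Lp_fun_def)
  moreover have "(LINT x|M. norm (f x) powr p) \<le> 1"
    using F(2) f Lp_class_in_unit_ball_iff[OF f(1) assms(2)] by simp
  ultimately show ?thesis
    using s(1)[of n] that by simp
qed

section \<open>The contradiction: two distant functions in a small weakly open set\<close>

theorem proposition3p1:
  fixes M :: "'w measure" and p :: real
  assumes "finite_measure M" and "0 < measure M (space M)"
    and "\<exists>x::'x::banach. x \<noteq> 0"
    and "1 \<le> p"
    and "BHP (Lp_space M p :: ('w \<Rightarrow> 'x) set nvs)"
  shows "BHP (nvs_of_type TYPE('x))"
proof (rule ccontr)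
  interpret finite_measure M by fact
  let ?X = "nvs_of_type TYPE('x)" and ?L = "Lp_space M p :: ('w \<Rightarrow> 'x) set nvs"
  assume "\<not> BHP ?X"
  then obtain \<epsilon> where \<epsilon>: "0 < \<epsilon>"
    and diam: "\<And>W. openin (subtopology (weak_topology ?X) (unit_ball ?X)) W \<Longrightarrow> W \<noteq> {} \<Longrightarrow>
      \<epsilon> \<le> vdiameter ?X W"
    unfolding BHP_def by (meson not_less)
  obtain W where W: "openin (subtopology (weak_topology ?L) (unit_ball ?L)) W" "W \<noteq> {}"
      "vdiameter ?L W < \<epsilon> / 2"
    using assms(5) \<epsilon> unfolding BHP_def by (meson half_gt_zero)
  obtain T where T: "openin (weak_topology ?L) T" "W = T \<inter> unit_ball ?L"
    using W(1) by (auto simp: openin_subtopology)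
  obtain F where "F \<in> T" "F \<in> unit_ball ?L" using W(2) T(2) by blast
  then obtain s where s: "simple_function M s" "Lp_class M p s \<in> T"
      "(LINT x|M. norm (s x) powr p) \<le> 1"
    using weakly_open_contains_simple_function[OF assms(1,4) T(1)] by metis
  obtain D \<eta> where D: "finite D" "D \<subseteq> dual_space ?L" "0 < \<eta>"
    "\<And>G. G \<in> pts ?L \<Longrightarrow> (\<And>\<phi>. \<phi> \<in> D \<Longrightarrow> \<bar>\<phi> G - \<phi> (Lp_class M p s)\<bar> < \<eta>) \<Longrightarrow> G \<in> T"
    using weak_topology_basic_nbhd[OF T(1) s(2)] by metis
  define I where "I = s ` space M"
  have I: "finite I" unfolding I_def using s(1) by (rule simple_functionD)
  \<comment> \<open>Positive total measure makes \<open>space M\<close> nonempty;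
    \<open>card I\<close> later divides the tolerance \<open>\<eta>\<close>.\<close>
  have "I \<noteq> {}" using assms(2) by (auto simp: I_def)
  then have cI: "0 < real (card I)" using I by (simp add: card_gt_0_iff)
  \<comment> \<open>\<open>\<psi> v \<phi>\<close> is the functional on \<open>'x\<close> that
    \<open>\<phi>\<close> induces on the level set where \<open>s\<close> equals
    \<open>v\<close>.\<close>
  define \<psi> where "\<psi> v \<phi> u = \<phi> (Lp_class M p (\<lambda>x. indicator (s -` {v} \<inter> space M) x *\<^sub>R u))"
    for v u :: 'x and \<phi> :: "('w \<Rightarrow> 'x) set \<Rightarrow> real"
  have \<psi>_sum: "\<phi> (Lp_class M p (\<lambda>x. y (s x))) = (\<Sum>v\<in>I. \<psi> v \<phi> (y v))" if "\<phi> \<in> D" for \<phi> y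
    unfolding \<psi>_def I_def using that D(2) assms(1,4) s(1) by (intro dual_Lp_simple_function) auto
  have \<psi>_lin: "bounded_linear (\<psi> v \<phi>)" if "\<phi> \<in> D" for \<phi> v
    unfolding \<psi>_def using that D(2) assms(1,4) simple_functionD(2)[OF s(1)]
    by (intro dual_Lp_indicator_bounded_linear) auto
  define N where "N = (LINT x|M. norm (s x) powr p)"
  \<comment> \<open>The missing mass \<open>1 - N\<close> is spread evenly over
    \<open>space M\<close>: the added constant integrates to \<open>1 - N\<close> and is nonnegative
    since \<open>N \<le> 1\<close>.\<close>
  define r where "r v = (norm v powr p + (1 - N) / measure M (space M)) powr (1 / p)" for v :: 'x
  have pos: "0 \<le> (1 - N) / measure M (space M)"
    using s(3) by (simp add: N_def)
  have r_powr: "r v powr p = norm v powr p + (1 - N) / measure M (space M)" for v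
    using pos assms(4) by (simp add: r_def powr_powr)
  have r_ge: "norm v \<le> r v" for v
  proof -
    have "(norm v powr p) powr (1 / p) \<le> r v"
      unfolding r_def using pos assms(4) by (intro powr_mono2) auto
    then show ?thesis using assms(4) by (simp add: powr_powr)
  qed
  have sLp: "(\<lambda>x. h (s x)) \<in> Lp_fun M p" for h :: "'x \<Rightarrow> 'x"
    using simple_function_compose1[OF s(1)] by (rule Lp_fun_simple_function)
  have int: "integrable M (\<lambda>x. h (s x))" for h :: "'x \<Rightarrow> real"
    using simple_function_compose1[OF s(1), of h]
    by (intro integrable_simple_function) (auto simp: emeasure_eq_measure)
  have r_int: "(LINT x|M. r (s x) powr p) = 1"
  proof -
    have "(LINT x|M. r (s x) powr p) = N + (LINT x|M. (1 - N) / measure M (space M))"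
      unfolding r_powr N_def by (intro Bochner_Integration.integral_add int integrable_const)
    then show ?thesis using assms(2) by simp
  qed
  \<comment> \<open>The tolerance is \<open>\<eta> / card I\<close> so that the errors over all
    values of \<open>s\<close> add up to less than \<open>\<eta>\<close>.\<close>
  have "\<exists>y z. norm y \<le> r v \<and> norm z \<le> r v \<and> r v * (\<epsilon> / 2) \<le> norm (y - z) \<and>
      (\<forall>\<phi>\<in>D. \<bar>\<psi> v \<phi> y - \<psi> v \<phi> v\<bar> < \<eta> / card I) \<and> (\<forall>\<phi>\<in>D. \<bar>\<psi> v \<phi> z - \<psi> v \<phi> v\<bar> < \<eta> / card I)" for v
    using not_BHP_far_points[OF diam \<epsilon> _ _ _ r_ge, of "\<psi> v ` D" "\<eta> / card I" v]
      D(1,3) cI \<psi>_lin by (smt (verit) divide_pos_pos finite_imageI imageE imageI)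
  then obtain y z where y: "\<And>v. norm (y v) \<le> r v"
      "\<And>v \<phi>. \<phi> \<in> D \<Longrightarrow> \<bar>\<psi> v \<phi> (y v) - \<psi> v \<phi> v\<bar> < \<eta> / card I"
    and z: "\<And>v. norm (z v) \<le> r v"
      "\<And>v \<phi>. \<phi> \<in> D \<Longrightarrow> \<bar>\<psi> v \<phi> (z v) - \<psi> v \<phi> v\<bar> < \<eta> / card I"
    and yz: "\<And>v. r v * (\<epsilon> / 2) \<le> norm (y v - z v)"
    by metis
  \<comment> \<open>Proved for any selection \<open>h\<close>, to serve both \<open>y\<close> and
    \<open>z\<close>. The tolerances place the class in \<open>T\<close>; the radii and
    \<open>r_int\<close> place it in the ball.\<close>
  have in_W: "Lp_class M p (\<lambda>x. h (s x)) \<in> W"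
    if h: "\<And>v. norm (h v) \<le> r v"
      "\<And>v \<phi>. \<phi> \<in> D \<Longrightarrow> \<bar>\<psi> v \<phi> (h v) - \<psi> v \<phi> v\<bar> < \<eta> / card I" for h
  proof -
    have "\<bar>\<phi> (Lp_class M p (\<lambda>x. h (s x))) - \<phi> (Lp_class M p s)\<bar> < \<eta>" if \<phi>: "\<phi> \<in> D" for \<phi>
    proof -
      \<comment> \<open>\<open>s\<close> itself is the relabelling by the identity, so both terms
        are sums over the same level sets.\<close>
      have "\<bar>\<phi> (Lp_class M p (\<lambda>x. h (s x))) - \<phi> (Lp_class M p s)\<bar>
          = \<bar>\<Sum>v\<in>I. \<psi> v \<phi> (h v) - \<psi> v \<phi> v\<bar>"
        using \<psi>_sum[OF \<phi>, of h] \<psi>_sum[OF \<phi>, of "\<lambda>v. v"] by (simp add: sum_subtractf)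
      also have "\<dots> \<le> (\<Sum>v\<in>I. \<bar>\<psi> v \<phi> (h v) - \<psi> v \<phi> v\<bar>)"
        by (rule sum_abs)
      also have "\<dots> < (\<Sum>v\<in>I. \<eta> / card I)"
        using I \<open>I \<noteq> {}\<close> h(2)[OF \<phi>] by (intro sum_strict_mono)
      also have "\<dots> = \<eta>" using cI by simp
      finally show ?thesis .
    qed
    then have "Lp_class M p (\<lambda>x. h (s x)) \<in> T"
      using sLp by (intro D(4)) (auto simp: pts_Lp_space)
    moreover have "(LINT x|M. norm (h (s x)) powr p) \<le> (LINT x|M. r (s x) powr p)"
      using h(1) assms(4) by (intro integral_mono int[of "\<lambda>v. norm (h v) powr p"]
          int[of "\<lambda>v. r v powr p"] powr_mono2) auto
    ultimately show ?thesis
      using T(2) r_int Lp_class_in_unit_ball_iff[OF sLp assms(4)] by simp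
  qed
  let ?Y = "Lp_class M p (\<lambda>x. y (s x))" and ?Z = "Lp_class M p (\<lambda>x. z (s x))"
  have Y: "?Y \<in> W" and Z: "?Z \<in> W"
    using in_W y z by blast+
  \<comment> \<open>The normalisation \<open>r_int\<close> enters as an equality here: with a
    smaller integral of \<open>r (s x) powr p\<close>, the lower bound for the distance would
    shrink.\<close>
  have "(\<epsilon> / 2) powr p = (LINT x|M. (r (s x) * (\<epsilon> / 2)) powr p)"
    using r_int by (simp only: powr_mult integral_mult_left_zero mult_1_left)
  also have "\<dots> \<le> (LINT x|M. norm (y (s x) - z (s x)) powr p)"
    using yz \<epsilon> assms(4) by (intro integral_mono int[of "\<lambda>v. norm (y v - z v) powr p"]
        int[of "\<lambda>v. (r v * (\<epsilon> / 2)) powr p"] powr_mono2) (auto simp: r_def)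
  finally have "((\<epsilon> / 2) powr p) powr (1 / p) \<le> Lp_seminorm M p (\<lambda>x. y (s x) - z (s x))"
    unfolding Lp_seminorm_def using assms(4) by (intro powr_mono2) auto
  then have "\<epsilon> / 2 \<le> vdist ?L ?Y ?Z"
    using \<epsilon> assms(4) by (simp add: vdist_Lp_class[OF sLp sLp] powr_powr)
  also have "\<dots> \<le> vdiameter ?L W"
    unfolding vdiameter_def
  proof -
    have "bdd_above ((\<lambda>(x, y). vdist ?L x y) ` (W \<times> W))"
      using T(2) by (intro bdd_above_mono[OF bdd_above_vdist_Lp_unit_ball[OF assms(4)]]) auto
    from cSUP_upper[OF _ this, of "(?Y, ?Z)"] Y Z
    show "vdist ?L ?Y ?Z \<le> (SUP (x, y)\<in>W \<times> W. vdist ?L x y)" by simp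
  qed
  finally show False using W(3) by simp
qed

end
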